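(* Let $\phi_1,\dots,\phi_N$ be finite Blaschke products with $\phi_j(0)=0$ for all $j$, and let $\tau$ be the action of $\mathbb{F}_N^+$ on $\mathbb{S}^1$ they generate. If $\tau$ is mixing at a double exponential rate on $\mathcal{H}_\theta$ for some $0<\theta<1$, then $\tau$ is exponentially mixing on $C^\alpha$ for every $0<\alpha\le1$.
   Context: $\mathbb{S}^1=\{|z|=1\}$, $d\mu(z)=\frac{1}{2\pi i}\frac{dz}{z}$ is normalized Lebesgue measure on $\mathbb{S}^1$. A finite Blaschke product is a map $\phi(z)=e^{i\psi}\prod_{i=1}^q\frac{z-\lambda_i}{1-\overline{\lambda_i}z}$ with $\psi\in[0,2\pi)$, $|\lambda_i|<1$, $q\ge1$; those fixing $0$ preserve $\mu$. $\mathbb{F}_N^+$ is the free semigroup of words $a=i_1\dots i_n$ in the letters $1,\dots,N$, with length $|a|=n$, acting by $\tau(a)z=\phi_{i_n}\circ\dots\circ\phi_{i_1}(z)$. The correlation function is $\mathcal{C}_{f,g}(a)=\left|\int_{\mathbb{S}^1}(f\circ\tau(a))\,\overline{g}\,d\mu-\int_{\mathbb{S}^1}f\,d\mu\int_{\mathbb{S}^1}\overline{g}\,d\mu\right|$. For $0<\theta<1$, $\mathcal{H}_\theta$ is the closure of the linear combinations of $z^k$, $k\in\mathbb{Z}$, with respect to $\|f\|_\theta=\sqrt{\sum_{k\in\mathbb{Z}}|f_k|^2\theta^{-2|k|}}$, where $f_k$ are the Fourier coefficients of $f$. $\tau$ is mixing at a double exponential rate on $\mathcal{H}_\theta$ if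 there exist $\beta,\gamma,C>0$ such that $\mathcal{C}_{f,g}(a)\le Ce^{-\beta e^{\gamma|a|}}\|f\|_\theta\|g\|_\theta$ for all $f,g\in\mathcal{H}_\theta$ and $a\in\mathbb{F}_N^+$. $C^\alpha$ is the space of $\alpha$-H\"older continuous functions on $\mathbb{S}^1$ with the usual H\"older norm; $\tau$ is exponentially mixing on $C^\alpha$ if there exist $\kappa,C>0$ such that $\mathcal{C}_{f,g}(a)\le Ce^{-\kappa|a|}\|f\|_{C^\alpha}\|g\|_{C^\alpha}$ for all $f,g\in C^\alpha$ and $a\in\mathbb{F}_N^+$. *)

theory Defs
  imports "HOL-Complex_Analysis.Complex_Analysis"
begin

text \<open>
  Functions on the unit circle are represented by functions \<^typ>\<open>complex \<Rightarrow> complex\<close> of which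
  only the values on \<^term>\<open>sphere (0::complex) 1\<close> matter.
\<close>

definition circle_measure :: "complex measure" where
  "circle_measure =
     distr (restrict_space lborel {0..1}) (restrict_space borel (sphere 0 1))
       (\<lambda>t::real. cis (2 * pi * t))"

lemma circle_measurable:
  "(\<lambda>t::real. cis (2 * pi * t))
     \<in> measurable (restrict_space lborel {0..1}) (restrict_space borel (sphere 0 1))"
proof (rule measurable_restrict_space2)
  show "(\<lambda>t::real. cis (2 * pi * t)) \<in> borel_measurable (restrict_space lborel {0..1})"
    by (intro measurable_restrict_space1)
       (simp, intro borel_measurable_continuous_onI continuous_intros)
qed auto

text \<open>This is the formula $d\mu(z) = \frac{1}{2\pi i}\frac{dz}{z}$ on continuous functions.\<close>

lemma integral_circle_measure:
  assumes "continuous_on (sphere 0 1) f"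
  shows "integral\<^sup>L circle_measure f
           = 1 / (2 * of_real pi * \<i>) * contour_integral (circlepath 0 1) (\<lambda>z. f z / z)"
proof -
  let ?e = "\<lambda>t::real. cis (2 * pi * t)"
  have e: "circlepath 0 1 = ?e"
    by (auto simp: circlepath cis_conv_exp algebra_simps)
  have f: "f \<in> borel_measurable (restrict_space borel (sphere 0 1))"
    by (rule borel_measurable_continuous_on_restrict[OF assms])
  have cont: "continuous_on {0..1} (\<lambda>t. f (?e t))"
    by (rule continuous_on_compose2[OF assms]) (auto intro!: continuous_intros)
  have "integral\<^sup>L circle_measure f = (LINT t|restrict_space lborel {0..1}. f (?e t))"
    unfolding circle_measure_def by (rule integral_distr[OF circle_measurable f])
  also have "\<dots> = (LINT t:{0..1}|lborel. f (?e t))"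
    unfolding set_lebesgue_integral_def by (rule integral_restrict_space) simp
  also have "\<dots> = integral {0..1} (\<lambda>t. f (?e t))"
    by (rule set_borel_integral_eq_integral[OF borel_integrable_atLeastAtMost'[OF cont]])
  finally have 1: "integral\<^sup>L circle_measure f = integral {0..1} (\<lambda>t. f (?e t))" .
  have "contour_integral (circlepath 0 1) (\<lambda>z. f z / z)
          = integral {0..1} (\<lambda>t. 2 * of_real pi * \<i> * f (?e t))"
    unfolding contour_integral_integral vector_derivative_circlepath unfolding e
    by (intro integral_cong) (auto simp: cis_conv_exp algebra_simps)
  then show ?thesis
    using 1 by simp
qed

definition finite_blaschke_product :: "(complex \<Rightarrow> complex) \<Rightarrow> bool" where
  "finite_blaschke_product \<phi> \<longleftrightarrow>
     (\<exists>(\<psi>::real) (q::nat) (lam::nat \<Rightarrow> complex).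
        0 \<le> \<psi> \<and> \<psi> < 2 * pi \<and> 1 \<le> q \<and> (\<forall>i\<in>{1..q}. cmod (lam i) < 1) \<and>
        (\<forall>z\<in>cball 0 1.
           \<phi> z = exp (\<i> * of_real \<psi>) * (\<Prod>i=1..q. (z - lam i) / (1 - cnj (lam i) * z))))"

text \<open>Words over the letters $1,\dots,N$; the free semigroup has no empty word.\<close>

definition free_semigroup :: "nat \<Rightarrow> nat list set" where
  "free_semigroup N = {a. a \<noteq> [] \<and> set a \<subseteq> {1..N}}"

text \<open>The first letter of the word acts first:
  \<^term>\<open>word_action \<phi> [i, j] z = \<phi> j (\<phi> i z)\<close>.\<close>

definition word_action :: "(nat \<Rightarrow> complex \<Rightarrow> complex) \<Rightarrow> nat list \<Rightarrow> complex \<Rightarrow> complex" where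
  "word_action \<phi> a z = fold \<phi> a z"

definition correlation ::
  "(nat \<Rightarrow> complex \<Rightarrow> complex) \<Rightarrow> (complex \<Rightarrow> complex) \<Rightarrow> (complex \<Rightarrow> complex) \<Rightarrow> nat list \<Rightarrow> real" where
  "correlation \<phi> f g a =
     cmod ((LINT z|circle_measure. f (word_action \<phi> a z) * cnj (g z))
           - (LINT z|circle_measure. f z) * (LINT z|circle_measure. cnj (g z)))"

definition fourier_coeff :: "(complex \<Rightarrow> complex) \<Rightarrow> int \<Rightarrow> complex" where
  "fourier_coeff f k = (LINT z|circle_measure. f z * cnj (z powi k))"

definition square_integrable :: "(complex \<Rightarrow> complex) \<Rightarrow> bool" where
  "square_integrable f \<longleftrightarrow>
     f \<in> borel_measurable circle_measure \<and> integrable circle_measure (\<lambda>z. (cmod (f z))\<^sup>2)"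

definition theta_norm_finite :: "real \<Rightarrow> (complex \<Rightarrow> complex) \<Rightarrow> bool" where
  "theta_norm_finite \<theta> f \<longleftrightarrow>
     (\<lambda>k::int. (cmod (fourier_coeff f k))\<^sup>2 * \<theta> powi (- 2 * \<bar>k\<bar>)) summable_on UNIV"

text \<open>Only meaningful where \<^const>\<open>theta_norm_finite\<close> holds, since \<^const>\<open>infsum\<close> is zero on
  families that are not summable.\<close>

definition theta_norm :: "real \<Rightarrow> (complex \<Rightarrow> complex) \<Rightarrow> real" where
  "theta_norm \<theta> f =
     sqrt (\<Sum>\<^sub>\<infinity>k::int. (cmod (fourier_coeff f k))\<^sup>2 * \<theta> powi (- 2 * \<bar>k\<bar>))"

definition trig_polynomials :: "(complex \<Rightarrow> complex) set" where
  "trig_polynomials =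
     {p. \<exists>(K::int set) (c::int \<Rightarrow> complex). finite K \<and> p = (\<lambda>z. \<Sum>k\<in>K. c k * z powi k)}"

text \<open>The closure is taken among the (representatives of) $L^2$ functions whose norm is finite.\<close>

definition H_theta :: "real \<Rightarrow> (complex \<Rightarrow> complex) set" where
  "H_theta \<theta> =
     {f. square_integrable f \<and> theta_norm_finite \<theta> f \<and>
         (\<forall>\<epsilon>>0. \<exists>p\<in>trig_polynomials. theta_norm \<theta> (\<lambda>z. f z - p z) < \<epsilon>)}"

definition mixing_double_exponential ::
  "nat \<Rightarrow> (nat \<Rightarrow> complex \<Rightarrow> complex) \<Rightarrow> real \<Rightarrow> bool" where
  "mixing_double_exponential N \<phi> \<theta> \<longleftrightarrow>
     (\<exists>\<beta>>0. \<exists>\<gamma>>0. \<exists>C>0. \<forall>f\<in>H_theta \<theta>. \<forall>g\<in>H_theta \<theta>. \<forall>a\<in>free_semigroup N.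
        correlation \<phi> f g a
          \<le> C * exp (- \<beta> * exp (\<gamma> * real (length a))) * theta_norm \<theta> f * theta_norm \<theta> g)"

definition holder_space :: "real \<Rightarrow> (complex \<Rightarrow> complex) set" where
  "holder_space \<alpha> =
     {f. \<exists>L. \<forall>x\<in>sphere 0 1. \<forall>y\<in>sphere 0 1. cmod (f x - f y) \<le> L * cmod (x - y) powr \<alpha>}"

text \<open>Both suprema are over sets that are bounded for members of \<^const>\<open>holder_space\<close>.\<close>

definition holder_norm :: "real \<Rightarrow> (complex \<Rightarrow> complex) \<Rightarrow> real" where
  "holder_norm \<alpha> f =
     (SUP z\<in>sphere 0 1. cmod (f z)) +
     (SUP (x, y)\<in>{(x, y). x \<in> sphere 0 1 \<and> y \<in> sphere 0 1 \<and> x \<noteq> y}.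
        cmod (f x - f y) / cmod (x - y) powr \<alpha>)"

definition mixing_exponential ::
  "nat \<Rightarrow> (nat \<Rightarrow> complex \<Rightarrow> complex) \<Rightarrow> real \<Rightarrow> bool" where
  "mixing_exponential N \<phi> \<alpha> \<longleftrightarrow>
     (\<exists>\<kappa>>0. \<exists>C>0. \<forall>f\<in>holder_space \<alpha>. \<forall>g\<in>holder_space \<alpha>. \<forall>a\<in>free_semigroup N.
        correlation \<phi> f g a
          \<le> C * exp (- \<kappa> * real (length a)) * holder_norm \<alpha> f * holder_norm \<alpha> g)"

end

theory Submission
  imports Defs "HOL-Probability.Probability_Measure"
begin

text \<open>
  The idea is to approximate Hoelder functions by trigonometric polynomials whose degree is
  chosen according to the length of the word.

  The Fejer mean \<open>p\<close> of degree less than \<open>n\<close> of a Hoelder function \<open>f\<close> differs from \<open>f\<close> by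
  at most a constant times \<open>n powr (- \<alpha> / 2)\<close>, uniformly on the circle
  (\<open>fejer_mean_error\<close>). This is not the optimal exponent, but any power of \<open>n\<close> suffices, and this
  one follows from the second moment of the Fejer kernel alone. On the other hand the Fourier
  coefficients of \<open>p\<close> are bounded by the supremum of \<open>f\<close> and live on frequencies of modulus at
  most \<open>n\<close>, so the \<open>\<theta>\<close>-norm of \<open>p\<close> grows only like \<open>sqrt n * (1 / \<theta>) ^ n\<close>
  (\<open>trig_sum_in_H_theta\<close>).

  Since the action maps the circle to itself, replacing \<open>f\<close> and \<open>g\<close> by their Fejer means changes
  the correlation by no more than a multiple of the uniform error (\<open>correlation_perturb\<close>), while
  the correlation of the means is controlled by the double exponential mixing. For a word of
  length \<open>l\<close> let \<open>X = exp (\<gamma> * l / 2)\<close> and let \<open>n\<close> be \<open>X\<close> rounded up. The mixing factor is then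
  \<open>exp (- \<beta> * X\<^sup>2)\<close>, whose quadratic exponent beats the growth \<open>(1 / \<theta>) ^ (2 * n)\<close> of the norms,
  which is exponential in \<open>X\<close> (\<open>quadratic_exponent_beats_linear\<close>). What remains is the
  approximation error, of order \<open>X powr (- \<alpha> / 2)\<close>, and this decays exponentially in \<open>l\<close> at the
  rate \<open>\<kappa> = \<alpha> * \<gamma> / 4\<close>.
\<close>

section \<open>Integration over the circle\<close>

lemma prob_space_circle_measure: "prob_space circle_measure"
proof -
  have "prob_space (restrict_space lborel {0..1::real})"
    by (rule prob_spaceI) (simp add: space_restrict_space emeasure_restrict_space)
  then show ?thesis
    unfolding circle_measure_def by (rule prob_space.prob_space_distr[OF _ circle_measurable])
qed

lemma space_circle_measure [simp]: "space circle_measure = sphere 0 1"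
  by (simp add: circle_measure_def space_restrict_space)

lemma measure_circle_measure [simp]: "measure circle_measure (sphere 0 1) = 1"
  using prob_space.prob_space[OF prob_space_circle_measure] by simp

lemma borel_measurable_circle_measure:
  fixes f :: "complex \<Rightarrow> 'b::topological_space"
  assumes "continuous_on (sphere 0 1) f"
  shows "f \<in> borel_measurable circle_measure"
  using borel_measurable_continuous_on_restrict[OF assms]
  by (simp add: circle_measure_def)

lemma integrable_circle_measure:
  fixes f :: "complex \<Rightarrow> 'b::{banach, second_countable_topology}"
  assumes "continuous_on (sphere 0 1) f"
  shows "integrable circle_measure f"
proof -
  have "finite_measure circle_measure"
    using prob_space_circle_measure by (rule prob_space.axioms)
  moreover have "bounded (f ` sphere 0 1)"
    by (intro compact_imp_bounded compact_continuous_image assms compact_sphere)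
  then obtain B where "\<forall>z\<in>sphere 0 1. norm (f z) \<le> B"
    by (auto simp: bounded_iff)
  ultimately show ?thesis
    by (intro finite_measure.integrable_const_bound[of _ _ B]
          borel_measurable_circle_measure assms AE_I2) auto
qed

lemma norm_integral_circle_le:
  fixes f :: "complex \<Rightarrow> 'b::{banach, second_countable_topology}"
  assumes "continuous_on (sphere 0 1) f" "continuous_on (sphere 0 1) b"
    and "\<And>z. z \<in> sphere 0 1 \<Longrightarrow> norm (f z) \<le> b z"
  shows "norm (LINT z|circle_measure. f z) \<le> (LINT z|circle_measure. b z)"
  by (rule Bochner_Integration.integral_norm_bound_integral)
     (use assms in \<open>auto intro: integrable_circle_measure\<close>)

lemma norm_integral_circle_le_const:
  fixes f :: "complex \<Rightarrow> 'b::{banach, second_countable_topology}"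
  assumes "continuous_on (sphere 0 1) f"
    and "\<And>z. z \<in> sphere 0 1 \<Longrightarrow> norm (f z) \<le> B"
  shows "norm (LINT z|circle_measure. f z) \<le> B"
  using norm_integral_circle_le[OF assms(1) continuous_on_const assms(2)] by simp

lemma continuous_on_circle_powi [continuous_intros]:
  "continuous_on (sphere 0 1) (\<lambda>z::complex. z powi k)"
  by (intro continuous_intros) auto

text \<open>
  For \<open>k \<noteq> 0\<close> the form \<open>z powi k * dz / z\<close> has the primitive \<open>z powi k / k\<close> on the punctured
  plane, so its integral over the closed circle vanishes. This is the orthogonality relation behind
  all computations with Fourier coefficients below.
\<close>

lemma integral_circle_powi:
  "(LINT z|circle_measure. z powi k) = (if k = 0 then 1 else 0)"
proof (cases "k = 0")
  case True
  then show ?thesis by simp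
next
  case False
  have "((\<lambda>z::complex. z powi k / z) has_contour_integral 0) (circlepath 0 1)"
  proof (rule Cauchy_theorem_primitive[where S = "-{0}" and f = "\<lambda>z. z powi k / of_int k"])
    fix z :: complex assume "z \<in> -{0}"
    then show "((\<lambda>z. z powi k / of_int k) has_field_derivative z powi k / z) (at z within -{0})"
      using False by (auto intro!: derivative_eq_intros simp: power_int_diff field_simps)
  qed (use path_image_circlepath[of 1 0] in auto)
  then have "contour_integral (circlepath 0 1) (\<lambda>z::complex. z powi k / z) = 0"
    by (rule contour_integral_unique)
  then show ?thesis
    using False integral_circle_measure[OF continuous_on_circle_powi, of k] by simp
qed

lemma cnj_powi_circle:
  assumes "cmod z = 1"
  shows "cnj (z powi k) = z powi (- k)"
proof -
  have "cnj z * z = 1"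
    using assms complex_norm_square[of z] by (simp add: mult.commute)
  then have "cnj z = inverse z"
    by (metis inverse_unique mult.commute)
  then show ?thesis
    by (simp add: power_int_minus power_int_inverse)
qed

section \<open>Hoelder functions\<close>

lemma continuous_on_holder:
  assumes "0 < \<alpha>" "f \<in> holder_space \<alpha>"
  shows "continuous_on (sphere 0 1) f"
proof -
  from assms obtain L where L: "\<And>x y. x \<in> sphere 0 1 \<Longrightarrow> y \<in> sphere 0 1 \<Longrightarrow>
      cmod (f x - f y) \<le> L * cmod (x - y) powr \<alpha>"
    unfolding holder_space_def by blast
  show ?thesis
    unfolding continuous_on_def
  proof
    fix x :: complex assume x: "x \<in> sphere 0 1"
    have "((\<lambda>y. cmod (y - x)) \<longlongrightarrow> 0) (at x within sphere 0 1)"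
      by (intro tendsto_norm_zero LIM_zero tendsto_ident_at)
    then have "((\<lambda>y. L * cmod (y - x) powr \<alpha>) \<longlongrightarrow> 0) (at x within sphere 0 1)"
      by (intro tendsto_mult_right_zero tendsto_zero_powrI[OF _ tendsto_const]) (use assms(1) in auto)
    moreover have "\<forall>\<^sub>F y in at x within sphere 0 1. cmod (f y - f x) \<le> L * cmod (y - x) powr \<alpha>"
      using L[OF _ x] by (simp add: eventually_at_filter)
    ultimately have "((\<lambda>y. f y - f x) \<longlongrightarrow> 0) (at x within sphere 0 1)"
      by (rule Lim_null_comparison[rotated])
    then show "(f \<longlongrightarrow> f x) (at x within sphere 0 1)"
      by (rule LIM_zero_cancel)
  qed
qed

text \<open>
  The supremum norm and the seminorm are each at most their sum, once both suprema are known to be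
  over bounded nonempty sets; the point \<open>1\<close> and the pair \<open>(1, - 1)\<close> show that they are
  nonnegative.
\<close>

lemma holder_norm_bounds:
  assumes \<alpha>: "0 < \<alpha>" and f: "f \<in> holder_space \<alpha>"
  shows "x \<in> sphere 0 1 \<Longrightarrow> cmod (f x) \<le> holder_norm \<alpha> f"
    and "x \<in> sphere 0 1 \<Longrightarrow> y \<in> sphere 0 1 \<Longrightarrow>
           cmod (f x - f y) \<le> holder_norm \<alpha> f * cmod (x - y) powr \<alpha>"
    and "0 \<le> holder_norm \<alpha> f"
proof -
  define P where "P = {(x, y). x \<in> sphere (0::complex) 1 \<and> y \<in> sphere (0::complex) 1 \<and> x \<noteq> y}"
  define q where "q = (\<lambda>(x, y). cmod (f x - f y) / cmod (x - y) powr \<alpha>)"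
  define S where "S = (SUP z\<in>sphere 0 1. cmod (f z))"
  define H where "H = (SUP t\<in>P. q t)"
  have norm: "holder_norm \<alpha> f = S + H"
    by (simp add: holder_norm_def S_def H_def P_def q_def)
  have "bounded (f ` sphere 0 1)"
    by (intro compact_imp_bounded compact_continuous_image continuous_on_holder[OF assms] compact_sphere)
  then obtain B where "\<forall>z\<in>sphere 0 1. cmod (f z) \<le> B"
    by (auto simp: bounded_iff)
  then have "bdd_above ((\<lambda>z. cmod (f z)) ` sphere 0 1)"
    by (auto intro!: bdd_aboveI2)
  then have S: "cmod (f z) \<le> S" if "z \<in> sphere 0 1" for z
    unfolding S_def using that by (intro cSUP_upper)
  from f obtain L where "\<And>x y. x \<in> sphere 0 1 \<Longrightarrow> y \<in> sphere 0 1 \<Longrightarrow>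
      cmod (f x - f y) \<le> L * cmod (x - y) powr \<alpha>"
    unfolding holder_space_def by blast
  then have "bdd_above (q ` P)"
    by (intro bdd_aboveI2[of _ _ L]) (auto simp: P_def q_def divide_le_eq)
  then have H: "q t \<le> H" if "t \<in> P" for t
    unfolding H_def using that by (intro cSUP_upper)
  have "S \<ge> 0" using S[of 1] norm_ge_zero[of "f 1"] by (simp del: norm_ge_zero)
  have "(1, -1) \<in> P" by (simp add: P_def)
  then have "q (1, -1) \<le> H" by (rule H)
  moreover have "0 \<le> q (1, -1)" by (simp add: q_def)
  ultimately have "0 \<le> H" by (rule order_trans[rotated])
  show "0 \<le> holder_norm \<alpha> f" using \<open>S \<ge> 0\<close> \<open>H \<ge> 0\<close> norm by simp
  show "cmod (f x) \<le> holder_norm \<alpha> f" if "x \<in> sphere 0 1" for x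
    using S[OF that] \<open>H \<ge> 0\<close> norm by simp
  show "cmod (f x - f y) \<le> holder_norm \<alpha> f * cmod (x - y) powr \<alpha>"
    if "x \<in> sphere 0 1" "y \<in> sphere 0 1" for x y
  proof (cases "x = y")
    case False
    then have "cmod (f x - f y) / cmod (x - y) powr \<alpha> \<le> holder_norm \<alpha> f"
      using H[of "(x, y)"] that \<open>S \<ge> 0\<close> norm by (simp add: P_def q_def)
    then show ?thesis using False by (simp add: divide_le_eq)
  qed simp
qed

section \<open>A quadratic against a linear exponent\<close>

text \<open>
  Completing the square absorbs the linear term into half of the quadratic one, up to the constant
  \<open>8 * \<eta>\<^sup>2 / \<beta>\<close>; the other half dominates the polynomial factor \<open>X\<^sup>2\<close> since \<open>y \<le> exp y\<close>.
\<close>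

lemma quadratic_exponent_beats_linear:
  fixes X \<beta> \<eta> :: real
  assumes "1 \<le> X" "0 < \<beta>"
  shows "5 * X * exp (4 * \<eta> * X - \<beta> * X\<^sup>2) \<le> 10 / \<beta> * exp (8 * \<eta>\<^sup>2 / \<beta>) / X"
proof -
  have "0 \<le> (4 * \<eta> - \<beta> * X)\<^sup>2 / (2 * \<beta>)" using assms by simp
  also have "\<dots> = 8 * \<eta>\<^sup>2 / \<beta> - 4 * \<eta> * X + \<beta> * X\<^sup>2 / 2"
    using assms by (simp add: power2_eq_square field_simps)
  finally have "exp (4 * \<eta> * X - \<beta> * X\<^sup>2) \<le> exp (8 * \<eta>\<^sup>2 / \<beta> - \<beta> * X\<^sup>2 / 2)" by simp
  then have "5 * X * exp (4 * \<eta> * X - \<beta> * X\<^sup>2)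
      \<le> 5 * X * exp (8 * \<eta>\<^sup>2 / \<beta> - \<beta> * X\<^sup>2 / 2)"
    using assms by simp
  also have "\<dots> = 10 / \<beta> * (\<beta> * X\<^sup>2 / 2) * exp (8 * \<eta>\<^sup>2 / \<beta> - \<beta> * X\<^sup>2 / 2) / X"
    using assms by (simp add: power2_eq_square field_simps)
  also have "\<dots> \<le> 10 / \<beta> * exp (\<beta> * X\<^sup>2 / 2) * exp (8 * \<eta>\<^sup>2 / \<beta> - \<beta> * X\<^sup>2 / 2) / X"
  proof -
    have "\<beta> * X\<^sup>2 / 2 \<le> exp (\<beta> * X\<^sup>2 / 2)"
      using exp_ge_add_one_self[of "\<beta> * X\<^sup>2 / 2"] by linarith
    then show ?thesis
      using assms by (intro divide_right_mono mult_right_mono mult_left_mono) simp_all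
  qed
  also have "\<dots> = 10 / \<beta> * exp (8 * \<eta>\<^sup>2 / \<beta>) / X"
    by (simp add: mult.assoc flip: exp_add)
  finally show ?thesis .
qed

section \<open>The action and the correlations\<close>

text \<open>
  For \<open>\<bar>z\<bar> = 1\<close> one has \<open>1 - cnj \<lambda> * z = z * cnj (z - \<lambda>)\<close>, so every Blaschke factor has modulus 1.
\<close>

lemma finite_blaschke_product_circle:
  assumes "finite_blaschke_product \<phi>"
  shows "continuous_on (sphere 0 1) \<phi>" "\<phi> ` sphere 0 1 \<subseteq> sphere 0 1"
proof -
  from assms obtain \<psi> :: real and q :: nat and lam where
    lam: "\<And>i. i \<in> {1..q} \<Longrightarrow> cmod (lam i) < 1" and
    eq: "\<And>z. z \<in> cball 0 1 \<Longrightarrow>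
       \<phi> z = exp (\<i> * of_real \<psi>) * (\<Prod>i=1..q. (z - lam i) / (1 - cnj (lam i) * z))"
    unfolding finite_blaschke_product_def by blast
  have nz: "1 - cnj (lam i) * z \<noteq> 0" if "i \<in> {1..q}" "cmod z = 1" for i z
  proof
    assume "1 - cnj (lam i) * z = 0"
    then have "cmod (cnj (lam i) * z) = 1" by simp
    then show False using lam[OF that(1)] that(2) by (simp add: norm_mult)
  qed
  have "continuous_on (sphere 0 1)
      (\<lambda>z. exp (\<i> * of_real \<psi>) * (\<Prod>i=1..q. (z - lam i) / (1 - cnj (lam i) * z)))"
    by (intro continuous_intros) (use nz in auto)
  then show "continuous_on (sphere 0 1) \<phi>"
    by (rule continuous_on_eq) (simp add: eq)
  have "cmod ((z - lam i) / (1 - cnj (lam i) * z)) = 1" if "i \<in> {1..q}" "cmod z = 1" for i z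
  proof -
    have "z * cnj z = 1" using that complex_norm_square[of z] by simp
    then have "1 - cnj (lam i) * z = z * cnj (z - lam i)" by (simp add: algebra_simps)
    then have "cmod (1 - cnj (lam i) * z) = cmod (z - lam i)"
      using that by (simp add: norm_mult del: complex_cnj_diff)
    moreover have "cmod (1 - cnj (lam i) * z) \<noteq> 0" using nz[OF that] by simp
    ultimately show ?thesis by (metis divide_self norm_divide)
  qed
  then show "\<phi> ` sphere 0 1 \<subseteq> sphere 0 1"
    by (auto simp: eq norm_mult simp flip: prod_norm)
qed

lemma word_action_circle:
  assumes "\<And>j. j \<in> set a \<Longrightarrow> finite_blaschke_product (\<phi> j)"
  shows "continuous_on (sphere 0 1) (word_action \<phi> a)"
    "word_action \<phi> a ` sphere 0 1 \<subseteq> sphere 0 1"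
proof -
  have "continuous_on (sphere 0 1) (fold \<phi> a) \<and> fold \<phi> a ` sphere 0 1 \<subseteq> sphere 0 1"
    using assms
  proof (induction a)
    case (Cons j a)
    note B = finite_blaschke_product_circle[of "\<phi> j"]
    have "continuous_on (sphere 0 1) (fold \<phi> a \<circ> \<phi> j)"
      using Cons B by (intro continuous_on_compose) (auto intro: continuous_on_subset)
    then show ?case using Cons B by (auto simp: image_comp[symmetric])
  qed simp
  then show "continuous_on (sphere 0 1) (word_action \<phi> a)"
    "word_action \<phi> a ` sphere 0 1 \<subseteq> sphere 0 1"
    by (auto simp: word_action_def[abs_def])
qed

lemma norm_product_diff_le:
  fixes a b c d :: complex
  assumes "cmod (a - c) \<le> e * A" "cmod (b - d) \<le> e * B" "cmod b \<le> B" "cmod c \<le> A" "0 \<le> e"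
  shows "cmod (a * b - c * d) \<le> 2 * e * A * B"
proof -
  have "a * b - c * d = (a - c) * b + c * (b - d)" by (simp add: algebra_simps)
  then have "cmod (a * b - c * d) \<le> cmod (a - c) * cmod b + cmod c * cmod (b - d)"
    by (metis norm_triangle_ineq norm_mult)
  also have "\<dots> \<le> (e * A) * B + A * (e * B)"
    using assms order_trans[OF norm_ge_zero assms(1)] order_trans[OF norm_ge_zero assms(4)]
    by (intro add_mono mult_mono) auto
  finally show ?thesis by (simp add: algebra_simps)
qed

text \<open>
  Both the correlation integral and the product of the means are bilinear in \<open>(f, cnj g)\<close>, so each
  moves by at most \<open>2 * e * A * B\<close> when \<open>f\<close> and \<open>g\<close> are perturbed uniformly by \<open>e * A\<close> and
  \<open>e * B\<close>. The perturbation is measured in the supremum norm because composition with a self-map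
  of the circle cannot increase it.
\<close>

lemma correlation_perturb:
  assumes T: "continuous_on (sphere 0 1) (word_action \<phi> a)"
      "word_action \<phi> a ` sphere 0 1 \<subseteq> sphere 0 1"
    and cont: "continuous_on (sphere 0 1) f" "continuous_on (sphere 0 1) g"
      "continuous_on (sphere 0 1) p" "continuous_on (sphere 0 1) q"
    and f: "\<And>z. z \<in> sphere 0 1 \<Longrightarrow> cmod (f z - p z) \<le> e * A"
      "\<And>z. z \<in> sphere 0 1 \<Longrightarrow> cmod (p z) \<le> A"
    and g: "\<And>z. z \<in> sphere 0 1 \<Longrightarrow> cmod (g z - q z) \<le> e * B"
      "\<And>z. z \<in> sphere 0 1 \<Longrightarrow> cmod (g z) \<le> B"
    and "0 \<le> e"
  shows "correlation \<phi> f g a \<le> correlation \<phi> p q a + 4 * e * A * B"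
proof -
  let ?T = "word_action \<phi> a"
  let ?I = "\<lambda>h :: complex \<Rightarrow> complex. LINT z|circle_measure. h z"
  have comp: "continuous_on (sphere 0 1) (\<lambda>z. h (?T z))"
    if "continuous_on (sphere 0 1) h" for h :: "complex \<Rightarrow> complex"
    by (rule continuous_on_compose2[OF that T])
  note ci = continuous_intros cont comp
  have diff: "?I h - ?I k = ?I (\<lambda>z. h z - k z)"
    if "continuous_on (sphere 0 1) h" "continuous_on (sphere 0 1) k" for h k
    using that by (intro Bochner_Integration.integral_diff[symmetric] integrable_circle_measure)
  have 1: "cmod (?I (\<lambda>z. f (?T z) * cnj (g z)) - ?I (\<lambda>z. p (?T z) * cnj (q z))) \<le> 2 * e * A * B"
  proof (subst diff)
    show "cmod (?I (\<lambda>z. f (?T z) * cnj (g z) - p (?T z) * cnj (q z))) \<le> 2 * e * A * B"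
    proof (rule norm_integral_circle_le_const)
      fix z :: complex assume z: "z \<in> sphere 0 1"
      then have Tz: "?T z \<in> sphere 0 1" using T(2) by blast
      show "cmod (f (?T z) * cnj (g z) - p (?T z) * cnj (q z)) \<le> 2 * e * A * B"
        using f[OF Tz] g[OF z] \<open>0 \<le> e\<close>
        by (intro norm_product_diff_le) (simp_all flip: complex_cnj_diff)
    qed (intro ci)
  qed (intro ci)+
  have 2: "cmod (?I f * ?I (\<lambda>z. cnj (g z)) - ?I p * ?I (\<lambda>z. cnj (q z))) \<le> 2 * e * A * B"
  proof (rule norm_product_diff_le)
    show "cmod (?I f - ?I p) \<le> e * A"
      by (subst diff, intro ci, intro ci, rule norm_integral_circle_le_const, intro ci, rule f)
    show "cmod (?I (\<lambda>z. cnj (g z)) - ?I (\<lambda>z. cnj (q z))) \<le> e * B"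
      by (subst diff, intro ci, intro ci, rule norm_integral_circle_le_const, intro ci)
         (use g in \<open>simp flip: complex_cnj_diff\<close>)
    show "cmod (?I (\<lambda>z. cnj (g z))) \<le> B"
      by (rule norm_integral_circle_le_const, intro ci) (use g in simp)
    show "cmod (?I p) \<le> A"
      by (rule norm_integral_circle_le_const, intro ci, rule f)
  qed fact
  have "cmod (x - y) \<le> cmod (x' - y') + 2 * D" if "cmod (x - x') \<le> D" "cmod (y - y') \<le> D"
    for x y x' y' :: complex and D
  proof -
    have "x - y = (x' - y') + ((x - x') - (y - y'))" by simp
    then have "cmod (x - y) \<le> cmod (x' - y') + cmod ((x - x') - (y - y'))"
      by (metis norm_triangle_ineq)
    also have "cmod ((x - x') - (y - y')) \<le> cmod (x - x') + cmod (y - y')"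
      by (rule norm_triangle_ineq4)
    finally show ?thesis using that by linarith
  qed
  from this[OF 1 2] show ?thesis
    unfolding correlation_def by (simp add: algebra_simps)
qed

section \<open>Trigonometric polynomials\<close>

lemma continuous_on_trig_sum:
  "continuous_on (sphere 0 1) (\<lambda>z. \<Sum>k\<in>K. c k * z powi k :: complex)"
  by (intro continuous_intros)

lemma fourier_coeff_trig_sum:
  assumes "finite K"
  shows "fourier_coeff (\<lambda>z. \<Sum>k\<in>K. c k * z powi k) m = (if m \<in> K then c m else 0)"
proof -
  have "fourier_coeff (\<lambda>z. \<Sum>k\<in>K. c k * z powi k) m
      = (LINT z|circle_measure. (\<Sum>k\<in>K. c k * z powi (k - m)))"
    unfolding fourier_coeff_def sum_distrib_right
  proof (intro Bochner_Integration.integral_cong refl sum.cong)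
    fix z :: complex and k assume "z \<in> space circle_measure"
    then have z: "cmod z = 1" by simp
    then have "z \<noteq> 0" by auto
    then show "c k * z powi k * cnj (z powi m) = c k * z powi (k - m)"
      unfolding cnj_powi_circle[OF z]
      by (simp add: power_int_diff power_int_minus divide_inverse)
  qed
  also have "\<dots> = (\<Sum>k\<in>K. c k * (LINT z|circle_measure. z powi (k - m)))"
    by (subst Bochner_Integration.integral_sum)
       (auto intro!: integrable_circle_measure continuous_intros)
  also have "\<dots> = (\<Sum>k\<in>K. if k = m then c m else 0)"
    by (intro sum.cong refl) (simp add: integral_circle_powi)
  finally show ?thesis using assms by simp
qed

text \<open>
  At most \<open>2 * n + 1\<close> frequencies contribute, and each weight is at most \<open>(1 / \<theta>) ^ (2 * n)\<close>.
\<close>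

lemma theta_norm_le:
  assumes \<theta>: "0 < \<theta>" "\<theta> < 1"
    and van: "\<And>k. \<bar>k\<bar> > int n \<Longrightarrow> fourier_coeff f k = 0"
    and le: "\<And>k. cmod (fourier_coeff f k) \<le> B"
  shows "theta_norm_finite \<theta> f" "theta_norm \<theta> f \<le> sqrt (2 * real n + 1) * B * (1 / \<theta>) ^ n"
proof -
  let ?t = "\<lambda>k. (cmod (fourier_coeff f k))\<^sup>2 * \<theta> powi (- 2 * \<bar>k\<bar>)"
  let ?K = "{- int n..int n}"
  have zero: "?t k = 0" if "k \<in> UNIV - ?K" for k
  proof -
    have "fourier_coeff f k = 0" by (rule van) (use that in auto)
    then show ?thesis by simp
  qed
  have "?t summable_on ?K" by (rule summable_on_finite) simp
  then show "theta_norm_finite \<theta> f"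
    unfolding theta_norm_finite_def
    by (subst summable_on_cong_neutral[of ?K UNIV ?t ?t]) (use zero in auto)
  have "0 \<le> B" using norm_ge_zero le[of 0] by (rule order_trans)
  have "?t k \<le> B\<^sup>2 * ((1 / \<theta>) ^ n)\<^sup>2" if "k \<in> ?K" for k
  proof -
    have "\<theta> powi (- 2 * \<bar>k\<bar>) = (1 / \<theta>) ^ (2 * nat \<bar>k\<bar>)"
      by (simp add: power_int_def nat_mult_distrib divide_inverse)
    also have "\<dots> \<le> (1 / \<theta>) ^ (2 * n)"
      using \<theta> that by (intro power_increasing) auto
    finally show ?thesis
      using le[of k] \<theta> by (intro mult_mono power_mono) (auto simp: power_even_eq)
  qed
  then have bound: "(\<Sum>k\<in>?K. ?t k) \<le> of_nat (card ?K) * (B\<^sup>2 * ((1 / \<theta>) ^ n)\<^sup>2)"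
    by (rule sum_bounded_above)
  have card: "of_nat (card ?K) = 2 * real n + 1"
    by simp
  have infsum: "infsum ?t UNIV = (\<Sum>k\<in>?K. ?t k)"
    by (subst infsum_cong_neutral[of ?K UNIV ?t ?t]) (use zero in auto)
  have "theta_norm \<theta> f \<le> sqrt ((2 * real n + 1) * (B\<^sup>2 * ((1 / \<theta>) ^ n)\<^sup>2))"
    unfolding theta_norm_def infsum by (rule real_sqrt_le_mono[OF bound[unfolded card]])
  also have "\<dots> = sqrt (2 * real n + 1) * B * (1 / \<theta>) ^ n"
    using \<open>0 \<le> B\<close> \<theta> by (simp add: real_sqrt_mult)
  finally show "theta_norm \<theta> f \<le> sqrt (2 * real n + 1) * B * (1 / \<theta>) ^ n" .
qed

lemma theta_norm_nonneg: "0 < \<theta> \<Longrightarrow> 0 \<le> theta_norm \<theta> f"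
  unfolding theta_norm_def by (intro real_sqrt_ge_zero infsum_nonneg) auto

text \<open>
  On a probability space the Fourier coefficients are bounded by the supremum of the function, so a
  uniform bound is all that the norm estimate needs.
\<close>

lemma trig_sum_in_H_theta:
  assumes \<theta>: "0 < \<theta>" "\<theta> < 1" and K: "K \<subseteq> {- int n..int n}"
    and p: "p = (\<lambda>z. \<Sum>k\<in>K. c k * z powi k)"
    and B: "\<And>z. z \<in> sphere 0 1 \<Longrightarrow> cmod (p z) \<le> B"
  shows "p \<in> H_theta \<theta>" "theta_norm \<theta> p \<le> sqrt (2 * real n + 1) * B * (1 / \<theta>) ^ n"
proof -
  have fin: "finite K" using K by (rule finite_subset) simp
  have cont: "continuous_on (sphere 0 1) p"
    unfolding p by (rule continuous_on_trig_sum)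
  have van: "fourier_coeff p k = 0" if "\<bar>k\<bar> > int n" for k
  proof -
    have "k \<notin> K" using that K by (auto dest!: subsetD)
    then show ?thesis unfolding p fourier_coeff_trig_sum[OF fin] by simp
  qed
  have le: "cmod (fourier_coeff p k) \<le> B" for k
    unfolding fourier_coeff_def
    by (rule norm_integral_circle_le_const)
       (use B in \<open>auto intro!: continuous_intros cont simp: norm_mult norm_power_int\<close>)
  show "theta_norm \<theta> p \<le> sqrt (2 * real n + 1) * B * (1 / \<theta>) ^ n"
    by (rule theta_norm_le(2)[OF \<theta> van le])
  have "theta_norm \<theta> (\<lambda>z. p z - p z) = 0"
    by (simp add: theta_norm_def fourier_coeff_def)
  moreover have "p \<in> trig_polynomials"
    unfolding trig_polynomials_def p using fin by blast
  moreover have "square_integrable p"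
    unfolding square_integrable_def
    by (intro conjI borel_measurable_circle_measure integrable_circle_measure continuous_intros cont)
  moreover have "theta_norm_finite \<theta> p"
    by (rule theta_norm_le(1)[OF \<theta> van le])
  ultimately show "p \<in> H_theta \<theta>"
    unfolding H_theta_def by (auto intro!: bexI[of _ p])
qed

section \<open>Fejer approximation\<close>

text \<open>
  The kernel is written as a squared modulus, which makes positivity and the second moment bound
  immediate. In the variable \<open>u = z * cnj w = exp (\<i> * t)\<close> it is the classical
  \<open>(sin (n * t / 2) / sin (t / 2))\<^sup>2 / n\<close>.
\<close>

definition fejer_kernel :: "nat \<Rightarrow> complex \<Rightarrow> complex \<Rightarrow> real" where
  "fejer_kernel n z w = (cmod (\<Sum>j<n. (z * cnj w) ^ j))\<^sup>2 / n"

text \<open>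
  Collecting the terms with \<open>j - k = m\<close> gives the usual Cesaro weights \<open>1 - \<bar>m\<bar> / n\<close>. The double
  sum is kept because it is what the expansion of the squared modulus in the kernel produces.
\<close>

definition fejer_mean :: "nat \<Rightarrow> (complex \<Rightarrow> complex) \<Rightarrow> complex \<Rightarrow> complex" where
  "fejer_mean n f z =
     (\<Sum>(j, k)\<in>{..<n} \<times> {..<n}. fourier_coeff f (int j - int k) * z powi (int j - int k)) / n"

lemma fejer_kernel_nonneg: "0 \<le> fejer_kernel n z w"
  by (simp add: fejer_kernel_def)

lemma continuous_on_fejer_kernel [continuous_intros]: "continuous_on S (fejer_kernel n z)"
  unfolding fejer_kernel_def divide_inverse by (intro continuous_intros)

text \<open>
  On the circle \<open>cnj u = inverse u\<close>, so the squared modulus of the geometric sum is a double sum of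
  the powers \<open>u powi (j - k)\<close>.
\<close>

lemma fejer_kernel_expand:
  assumes "cmod z = 1" "cmod w = 1"
  shows "complex_of_real (fejer_kernel n z w) =
    (\<Sum>(j, k)\<in>{..<n} \<times> {..<n}. z powi (int j - int k) * cnj (w powi (int j - int k))) / n"
proof -
  define u where "u = z * cnj w"
  have u: "cmod u = 1" using assms by (simp add: u_def norm_mult)
  then have "u \<noteq> 0" by auto
  have "complex_of_real (fejer_kernel n z w) = (\<Sum>j<n. u ^ j) * cnj (\<Sum>k<n. u ^ k) / n"
    unfolding fejer_kernel_def u_def[symmetric]
    by (simp only: of_real_divide complex_norm_square of_real_of_nat_eq)
  also have "(\<Sum>j<n. u ^ j) * cnj (\<Sum>k<n. u ^ k) = (\<Sum>(j, k)\<in>{..<n} \<times> {..<n}. u ^ j * cnj (u ^ k))"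
    by (simp add: sum_product sum.cartesian_product)
  also have "\<dots> = (\<Sum>(j, k)\<in>{..<n} \<times> {..<n}.
      z powi (int j - int k) * cnj (w powi (int j - int k)))"
  proof (intro sum.cong refl, clarify)
    fix j k
    have "u ^ j * cnj (u ^ k) = u powi int j * cnj (u powi int k)" by simp
    also have "\<dots> = u powi (int j - int k)"
      unfolding cnj_powi_circle[OF u] using \<open>u \<noteq> 0\<close>
      by (simp add: power_int_diff power_int_minus divide_inverse)
    also have "\<dots> = z powi (int j - int k) * cnj (w powi (int j - int k))"
      by (simp add: u_def power_int_mult_distrib complex_cnj_power_int)
    finally show "u ^ j * cnj (u ^ k) = z powi (int j - int k) * cnj (w powi (int j - int k))" .
  qed
  finally show ?thesis .
qed

lemma fejer_mean_eq_integral: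
  assumes f: "continuous_on (sphere 0 1) f" and z: "cmod z = 1"
  shows "fejer_mean n f z = (LINT w|circle_measure. f w * of_real (fejer_kernel n z w))"
proof -
  have "(LINT w|circle_measure. f w * of_real (fejer_kernel n z w)) =
    (LINT w|circle_measure. (\<Sum>(j, k)\<in>{..<n} \<times> {..<n}.
       z powi (int j - int k) / n * (f w * cnj (w powi (int j - int k)))))"
    by (intro Bochner_Integration.integral_cong refl)
       (auto simp: fejer_kernel_expand[OF z] sum_distrib_left sum_divide_distrib case_prod_unfold
          mult_ac intro!: sum.cong)
  also have "\<dots> = (\<Sum>(j, k)\<in>{..<n} \<times> {..<n}.
       z powi (int j - int k) / n * fourier_coeff f (int j - int k))"
    unfolding case_prod_unfold fourier_coeff_def
    by (subst Bochner_Integration.integral_sum)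
       (auto intro!: integrable_circle_measure continuous_intros f)
  also have "\<dots> = fejer_mean n f z"
    by (auto simp: fejer_mean_def sum_divide_distrib case_prod_unfold mult_ac intro!: sum.cong)
  finally show ?thesis ..
qed

text \<open>
  The integral is the Fejer mean of the constant function 1, in which only the \<open>n\<close> diagonal terms
  \<open>j = k\<close> survive.
\<close>

lemma integral_fejer_kernel:
  assumes "0 < n" "cmod z = 1"
  shows "(LINT w|circle_measure. fejer_kernel n z w) = 1"
proof -
  have one: "fourier_coeff (\<lambda>_. 1) m = (if m = 0 then 1 else 0)" for m
    using fourier_coeff_trig_sum[of "{0}" "\<lambda>_. 1" m] by simp
  have "complex_of_real (LINT w|circle_measure. fejer_kernel n z w) = fejer_mean n (\<lambda>_. 1) z"
    unfolding fejer_mean_eq_integral[OF continuous_on_const assms(2)] by simp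
  also have "\<dots> = (\<Sum>j<n. \<Sum>k<n. if j = k then 1 else 0 :: complex) / of_nat n"
    unfolding fejer_mean_def sum.cartesian_product
    by (intro arg_cong2[of _ _ _ _ "(/)"] sum.cong refl) (auto simp: one)
  also have "\<dots> = 1" using assms by simp
  finally show ?thesis by simp
qed

text \<open>
  The factor \<open>\<bar>z - w\<bar> = \<bar>1 - u\<bar>\<close>, with \<open>u = z * cnj w\<close>, telescopes the geometric sum in the
  kernel to \<open>1 - u ^ n\<close>, whose modulus is at most 2.
\<close>

lemma fejer_kernel_concentrated:
  assumes "cmod z = 1" "cmod w = 1"
  shows "(cmod (z - w))\<^sup>2 * fejer_kernel n z w \<le> 4 / n"
proof -
  define u where "u = z * cnj w"
  have u: "cmod u = 1" using assms by (simp add: u_def norm_mult)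
  have "w * cnj w = 1" using assms(2) complex_norm_square[of w] by simp
  then have "z - w = w * (u - 1)" by (simp add: u_def algebra_simps)
  then have "cmod (z - w) = cmod (1 - u)"
    using assms by (simp add: norm_mult norm_minus_commute)
  then have "(cmod (z - w))\<^sup>2 * fejer_kernel n z w = (cmod ((1 - u) * (\<Sum>j<n. u ^ j)))\<^sup>2 / n"
    by (simp add: fejer_kernel_def u_def norm_mult power_mult_distrib)
  also have "(1 - u) * (\<Sum>j<n. u ^ j) = 1 - u ^ n"
    by (rule one_diff_power_eq[symmetric])
  also have "(cmod (1 - u ^ n))\<^sup>2 \<le> 2\<^sup>2"
    using norm_triangle_ineq4[of 1 "u ^ n"] u by (intro power_mono) (auto simp: norm_power)
  finally show ?thesis by (simp add: divide_right_mono)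
qed

lemma fejer_mean_bound:
  assumes f: "continuous_on (sphere 0 1) f" and "0 < n" and z: "z \<in> sphere 0 1"
    and B: "\<And>w. w \<in> sphere 0 1 \<Longrightarrow> cmod (f w) \<le> B"
  shows "cmod (fejer_mean n f z) \<le> B"
proof -
  have z1: "cmod z = 1" using z by simp
  have "cmod (fejer_mean n f z) \<le> (LINT w|circle_measure. B * fejer_kernel n z w)"
    unfolding fejer_mean_eq_integral[OF f z1]
    by (intro norm_integral_circle_le continuous_intros f)
       (auto simp: norm_mult fejer_kernel_nonneg intro!: mult_right_mono B)
  then show ?thesis using integral_fejer_kernel[OF \<open>0 < n\<close>, of z] z by simp
qed

text \<open>
  Splitting at the scale \<open>\<delta>\<close> replaces the modulus of continuity \<open>d powr \<alpha>\<close> by a quadratic one,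
  which can be integrated against the kernel by means of \<open>fejer_kernel_concentrated\<close>.
\<close>

lemma powr_le_add_square:
  fixes d :: real
  assumes "0 < \<delta>" "0 \<le> d" "0 < \<alpha>" "\<alpha> \<le> 2"
  shows "d powr \<alpha> \<le> \<delta> powr \<alpha> + \<delta> powr (\<alpha> - 2) * d\<^sup>2"
proof (cases "d \<le> \<delta>")
  case True
  then have "d powr \<alpha> \<le> \<delta> powr \<alpha>" using assms by (intro powr_mono2) auto
  then show ?thesis by (simp add: add_increasing2)
next
  case False
  then have "d powr \<alpha> = d powr (\<alpha> - 2) * d\<^sup>2"
    using assms by (simp add: powr_diff powr_numeral)
  also have "\<dots> \<le> \<delta> powr (\<alpha> - 2) * d\<^sup>2"
    using assms False by (intro mult_right_mono powr_mono2') auto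
  finally show ?thesis by (simp add: add_increasing)
qed

text \<open>
  The error is the integral of \<open>f z - f w\<close> against the kernel, a probability density in \<open>w\<close>. After
  the splitting at scale \<open>\<delta>\<close> the near part contributes \<open>\<delta> powr \<alpha>\<close> and the far part
  \<open>\<delta> powr (\<alpha> - 2) * 4 / n\<close>; these are of the same order for \<open>\<delta> = 1 / sqrt n\<close>.
\<close>

lemma fejer_mean_error:
  assumes f: "continuous_on (sphere 0 1) f" and n: "0 < n" and z: "z \<in> sphere 0 1"
    and \<alpha>: "0 < \<alpha>" "\<alpha> \<le> 2" and "0 \<le> L"
    and hol: "\<And>w. w \<in> sphere 0 1 \<Longrightarrow> cmod (f z - f w) \<le> L * cmod (z - w) powr \<alpha>"
  shows "cmod (f z - fejer_mean n f z) \<le> 5 * L * real n powr (- \<alpha> / 2)"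
proof -
  let ?K = "fejer_kernel n z"
  define \<delta> where "\<delta> = real n powr (- 1 / 2)"
  have z1: "cmod z = 1" using z by simp
  have \<delta>: "0 < \<delta>" using n by (simp add: \<delta>_def)
  have "f z - fejer_mean n f z = (LINT w|circle_measure. f z * of_real (?K w))
      - (LINT w|circle_measure. f w * of_real (?K w))"
    using integral_fejer_kernel[OF n z1] by (simp add: fejer_mean_eq_integral[OF f z1])
  also have "\<dots> = (LINT w|circle_measure. (f z - f w) * of_real (?K w))"
    unfolding left_diff_distrib
    by (intro Bochner_Integration.integral_diff[symmetric] integrable_circle_measure
          continuous_intros f)
  finally have "cmod (f z - fejer_mean n f z)
      = cmod (LINT w|circle_measure. (f z - f w) * of_real (?K w))" by simp
  also have "\<dots> \<le> (LINT w|circle_measure.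
      L * \<delta> powr \<alpha> * ?K w + L * \<delta> powr (\<alpha> - 2) * (4 / n))"
  proof (rule norm_integral_circle_le)
    fix w :: complex assume w: "w \<in> sphere 0 1"
    have "cmod (f z - f w) * ?K w \<le> L * cmod (z - w) powr \<alpha> * ?K w"
      using hol[OF w] by (rule mult_right_mono[OF _ fejer_kernel_nonneg])
    also have "\<dots> \<le> L * (\<delta> powr \<alpha> + \<delta> powr (\<alpha> - 2) * (cmod (z - w))\<^sup>2) * ?K w"
      using \<open>0 \<le> L\<close> \<delta> \<alpha>
      by (intro mult_right_mono mult_left_mono powr_le_add_square fejer_kernel_nonneg) auto
    also have "\<dots> = L * \<delta> powr \<alpha> * ?K w + L * \<delta> powr (\<alpha> - 2) * ((cmod (z - w))\<^sup>2 * ?K w)"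
      by (simp add: algebra_simps)
    also have "\<dots> \<le> L * \<delta> powr \<alpha> * ?K w + L * \<delta> powr (\<alpha> - 2) * (4 / n)"
      using \<open>0 \<le> L\<close> w by (intro add_left_mono mult_left_mono fejer_kernel_concentrated z1) auto
    finally show "cmod ((f z - f w) * of_real (?K w))
        \<le> L * \<delta> powr \<alpha> * ?K w + L * \<delta> powr (\<alpha> - 2) * (4 / n)"
      by (simp add: norm_mult fejer_kernel_nonneg)
  qed (intro continuous_intros f)+
  also have "\<dots> = L * \<delta> powr \<alpha> * (LINT w|circle_measure. ?K w)
      + (LINT w|circle_measure. L * \<delta> powr (\<alpha> - 2) * (4 / n))"
    by (subst Bochner_Integration.integral_add)
       (auto intro!: integrable_circle_measure continuous_intros)
  also have "\<dots> = L * \<delta> powr \<alpha> + L * \<delta> powr (\<alpha> - 2) * (4 / n)"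
    by (simp add: integral_fejer_kernel[OF n z1])
  also have "\<delta> powr \<alpha> = real n powr (- \<alpha> / 2)"
    by (simp add: \<delta>_def powr_powr)
  also have "\<delta> powr (\<alpha> - 2) = real n powr (- \<alpha> / 2 + 1)"
    by (simp add: \<delta>_def powr_powr diff_divide_distrib)
  also have "\<dots> = real n powr (- \<alpha> / 2) * n"
    unfolding powr_add using n by simp
  finally show ?thesis using n by (simp add: field_simps)
qed

text \<open>
  The terms are grouped by the value of \<open>j - k\<close>. The bound on the frequencies is what the estimate of
  the \<open>\<theta>\<close>-norm requires.
\<close>

lemma fejer_mean_trig_sum:
  obtains K c where "K \<subseteq> {- int n..int n}"
    "fejer_mean n f = (\<lambda>z. \<Sum>k\<in>K. c k * z powi k)"
proof -
  let ?S = "{..<n} \<times> {..<n}"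
  let ?d = "\<lambda>(j, k). int j - int k"
  show ?thesis
  proof (rule that)
    show "?d ` ?S \<subseteq> {- int n..int n}" by auto
    show "fejer_mean n f = (\<lambda>z. \<Sum>m\<in>?d ` ?S.
        (\<Sum>x\<in>{x \<in> ?S. ?d x = m}. fourier_coeff f m / n) * z powi m)"
    proof
      fix z
      have "fejer_mean n f z = (\<Sum>x\<in>?S. fourier_coeff f (?d x) / n * z powi ?d x)"
        by (auto simp: fejer_mean_def sum_divide_distrib intro!: sum.cong)
      also have "\<dots> = (\<Sum>m\<in>?d ` ?S. \<Sum>x\<in>{x \<in> ?S. ?d x = m}.
          fourier_coeff f (?d x) / n * z powi ?d x)"
        by (rule sum.image_gen) simp
      also have "\<dots> = (\<Sum>m\<in>?d ` ?S. (\<Sum>x\<in>{x \<in> ?S. ?d x = m}. fourier_coeff f m / n) * z powi m)"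
        unfolding sum_distrib_right by (intro sum.cong refl) auto
      finally show "fejer_mean n f z = (\<Sum>m\<in>?d ` ?S.
        (\<Sum>x\<in>{x \<in> ?S. ?d x = m}. fourier_coeff f m / n) * z powi m)" .
    qed
  qed
qed

section \<open>Mixing of Hoelder functions\<close>

text \<open>
  This is the estimate for one word with the degree \<open>n\<close> still free: large \<open>n\<close> decreases the
  approximation error but increases the \<open>\<theta>\<close>-norms of the Fejer means. Here \<open>D\<close> stands for the
  double exponential factor that belongs to the word.
\<close>

lemma correlation_holder_le:
  assumes \<theta>: "0 < \<theta>" "\<theta> < 1" and \<alpha>: "0 < \<alpha>" "\<alpha> \<le> 2" and n: "0 < n" and "0 \<le> D"
    and a: "\<And>j. j \<in> set a \<Longrightarrow> finite_blaschke_product (\<phi> j)"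
    and mix: "\<And>p q. p \<in> H_theta \<theta> \<Longrightarrow> q \<in> H_theta \<theta> \<Longrightarrow>
        correlation \<phi> p q a \<le> D * theta_norm \<theta> p * theta_norm \<theta> q"
    and f: "f \<in> holder_space \<alpha>" and g: "g \<in> holder_space \<alpha>"
  shows "correlation \<phi> f g a \<le>
    (D * (2 * real n + 1) * ((1 / \<theta>) ^ n)\<^sup>2 + 20 * real n powr (- \<alpha> / 2))
      * holder_norm \<alpha> f * holder_norm \<alpha> g"
proof -
  let ?b = "sqrt (2 * real n + 1)" and ?t = "(1 / \<theta>) ^ n"
  have *: "fejer_mean n h \<in> H_theta \<theta>"
    "theta_norm \<theta> (fejer_mean n h) \<le> ?b * holder_norm \<alpha> h * ?t"
    "continuous_on (sphere 0 1) (fejer_mean n h)"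
    "\<And>z. z \<in> sphere 0 1 \<Longrightarrow> cmod (fejer_mean n h z) \<le> holder_norm \<alpha> h"
    "\<And>z. z \<in> sphere 0 1 \<Longrightarrow>
       cmod (h z - fejer_mean n h z) \<le> 5 * real n powr (- \<alpha> / 2) * holder_norm \<alpha> h"
    if h: "h \<in> holder_space \<alpha>" for h
  proof -
    note hb = holder_norm_bounds[OF \<alpha>(1) h] and hc = continuous_on_holder[OF \<alpha>(1) h]
    obtain K c where K: "K \<subseteq> {- int n..int n}"
      and eq: "fejer_mean n h = (\<lambda>z. \<Sum>k\<in>K. c k * z powi k)"
      by (rule fejer_mean_trig_sum)
    show b: "\<And>z. z \<in> sphere 0 1 \<Longrightarrow> cmod (fejer_mean n h z) \<le> holder_norm \<alpha> h"
      by (rule fejer_mean_bound[OF hc n]) (auto intro: hb(1))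
    show "fejer_mean n h \<in> H_theta \<theta>" "theta_norm \<theta> (fejer_mean n h) \<le> ?b * holder_norm \<alpha> h * ?t"
      by (rule trig_sum_in_H_theta[OF \<theta> K eq b]; assumption)+
    show "continuous_on (sphere 0 1) (fejer_mean n h)"
      unfolding eq by (rule continuous_on_trig_sum)
    show "cmod (h z - fejer_mean n h z) \<le> 5 * real n powr (- \<alpha> / 2) * holder_norm \<alpha> h"
      if "z \<in> sphere 0 1" for z
      using fejer_mean_error[OF hc n that \<alpha> hb(3) hb(2)[OF that]] by (simp add: mult_ac)
  qed
  note F = *[OF f] and G = *[OF g]
  note norms = holder_norm_bounds(3)[OF \<alpha>(1) f] holder_norm_bounds(3)[OF \<alpha>(1) g]
  have "correlation \<phi> f g a \<le> correlation \<phi> (fejer_mean n f) (fejer_mean n g) a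
      + 4 * (5 * real n powr (- \<alpha> / 2)) * holder_norm \<alpha> f * holder_norm \<alpha> g"
    by (rule correlation_perturb[OF word_action_circle continuous_on_holder[OF \<alpha>(1) f]
          continuous_on_holder[OF \<alpha>(1) g] F(3) G(3) F(5,4) G(5) holder_norm_bounds(1)[OF \<alpha>(1) g]])
       (use a in auto)
  also have "correlation \<phi> (fejer_mean n f) (fejer_mean n g) a
      \<le> D * theta_norm \<theta> (fejer_mean n f) * theta_norm \<theta> (fejer_mean n g)"
    by (rule mix[OF F(1) G(1)])
  also have "\<dots> \<le> D * (?b * holder_norm \<alpha> f * ?t) * (?b * holder_norm \<alpha> g * ?t)"
    using \<open>0 \<le> D\<close> F(2) G(2) norms \<theta>
    by (intro mult_mono mult_nonneg_nonneg theta_norm_nonneg) auto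
  also have "\<dots> = D * (?b * ?b) * ?t\<^sup>2 * holder_norm \<alpha> f * holder_norm \<alpha> g"
    by (simp only: power2_eq_square mult_ac)
  also have "?b * ?b = 2 * real n + 1" by simp
  finally show ?thesis by (simp add: algebra_simps)
qed

text \<open>
  The degree \<open>n\<close> is taken close to \<open>X = exp (\<gamma> * length a / 2)\<close>, so that the mixing factor is
  \<open>exp (- \<beta> * X\<^sup>2)\<close>. Any power of \<open>exp (\<gamma> * length a)\<close> with exponent strictly between 0 and 1 would
  do: the degree must grow exponentially in the length of the word, for the approximation error to
  decay, but more slowly than the exponent of the mixing factor.
\<close>

lemma mixing_exponential_if_double_exponential:
  assumes \<theta>: "0 < \<theta>" "\<theta> < 1" and \<alpha>: "0 < \<alpha>" "\<alpha> \<le> 1"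
    and blaschke: "\<And>j. j \<in> {1..N} \<Longrightarrow> finite_blaschke_product (\<phi> j)"
    and double: "mixing_double_exponential N \<phi> \<theta>"
  shows "mixing_exponential N \<phi> \<alpha>"
proof -
  from double obtain \<beta> \<gamma> C where pos: "0 < \<beta>" "0 < \<gamma>" "0 < C"
    and mix: "\<And>f g a. f \<in> H_theta \<theta> \<Longrightarrow> g \<in> H_theta \<theta> \<Longrightarrow> a \<in> free_semigroup N \<Longrightarrow>
      correlation \<phi> f g a
        \<le> C * exp (- \<beta> * exp (\<gamma> * real (length a))) * theta_norm \<theta> f * theta_norm \<theta> g"
    unfolding mixing_double_exponential_def by blast
  define \<eta> where "\<eta> = ln (1 / \<theta>)"
  define M where "M = C * (10 / \<beta> * exp (8 * \<eta>\<^sup>2 / \<beta>)) + 20"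
  (* The approximation error alone has the order X powr (- \<alpha> / 2),
     which is exp (- \<kappa> * length a); the mixing term is of order 1 / X and hence smaller. *)
  define \<kappa> where "\<kappa> = \<alpha> * \<gamma> / 4"
  have \<eta>: "0 < \<eta>" "1 / \<theta> = exp \<eta>" using \<theta> by (auto simp: \<eta>_def)
  have "correlation \<phi> f g a \<le> M * exp (- \<kappa> * real (length a)) * holder_norm \<alpha> f * holder_norm \<alpha> g"
    if f: "f \<in> holder_space \<alpha>" and g: "g \<in> holder_space \<alpha>" and a: "a \<in> free_semigroup N" for f g a
  proof -
    define X where "X = exp (\<gamma> * real (length a) / 2)"
    define n where "n = nat \<lceil>X\<rceil>"
    define D where "D = C * exp (- \<beta> * X\<^sup>2)"
    have X: "1 \<le> X" using pos by (simp add: X_def)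
    have n: "X \<le> real n" "real n \<le> 2 * X" "0 < n"
      using X by (auto simp: n_def) linarith+
    have X2: "X\<^sup>2 = exp (\<gamma> * real (length a))"
      by (simp add: X_def power2_eq_square flip: exp_add)
    have rate: "X powr (- \<alpha> / 2) = exp (- \<kappa> * real (length a))"
      by (simp add: X_def \<kappa>_def powr_def)
    have "correlation \<phi> f g a \<le>
        (D * (2 * real n + 1) * ((1 / \<theta>) ^ n)\<^sup>2 + 20 * real n powr (- \<alpha> / 2))
        * holder_norm \<alpha> f * holder_norm \<alpha> g"
      by (rule correlation_holder_le[OF \<theta> _ _ n(3) _ _ _ f g])
         (use \<alpha> a blaschke mix pos in \<open>auto simp: D_def X2 free_semigroup_def subset_iff\<close>)
    also have "\<dots> \<le> M * exp (- \<kappa> * real (length a)) * holder_norm \<alpha> f * holder_norm \<alpha> g"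
    proof (intro mult_right_mono)
      have "((1 / \<theta>) ^ n)\<^sup>2 = exp (2 * \<eta> * real n)"
        by (simp add: \<eta> power2_eq_square flip: exp_of_nat_mult exp_add)
      also have "\<dots> \<le> exp (4 * \<eta> * X)" using n \<eta> by simp
      (* 2 * n + 1 \<le> 4 * X + 1 \<le> 5 * X *)
      finally have "D * (2 * real n + 1) * ((1 / \<theta>) ^ n)\<^sup>2 \<le> D * (5 * X) * exp (4 * \<eta> * X)"
        using n X pos by (intro mult_mono) (auto simp: D_def)
      also have "\<dots> = C * (5 * X * exp (4 * \<eta> * X - \<beta> * X\<^sup>2))"
        by (simp add: D_def exp_diff exp_minus field_simps)
      also have "\<dots> \<le> C * (10 / \<beta> * exp (8 * \<eta>\<^sup>2 / \<beta>) / X)"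
        using pos X by (intro mult_left_mono quadratic_exponent_beats_linear) auto
      also have "\<dots> = C * (10 / \<beta> * exp (8 * \<eta>\<^sup>2 / \<beta>)) * X powr (- 1)"
        using X by (simp add: powr_minus_divide)
      also have "\<dots> \<le> C * (10 / \<beta> * exp (8 * \<eta>\<^sup>2 / \<beta>)) * X powr (- \<alpha> / 2)"
        using X \<alpha> pos by (intro mult_left_mono powr_mono) auto
      finally have "D * (2 * real n + 1) * ((1 / \<theta>) ^ n)\<^sup>2
          \<le> C * (10 / \<beta> * exp (8 * \<eta>\<^sup>2 / \<beta>)) * X powr (- \<alpha> / 2)" .
      moreover have "real n powr (- \<alpha> / 2) \<le> X powr (- \<alpha> / 2)"
        using X n \<alpha> by (intro powr_mono2') auto
      ultimately show "D * (2 * real n + 1) * ((1 / \<theta>) ^ n)\<^sup>2 + 20 * real n powr (- \<alpha> / 2)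
          \<le> M * exp (- \<kappa> * real (length a))"
        unfolding M_def rate[symmetric] by (simp add: algebra_simps)
    qed (use holder_norm_bounds(3)[of \<alpha>] \<alpha> f g in auto)
    finally show ?thesis .
  qed
  moreover have "0 < \<kappa>" "0 < M" using \<alpha> pos by (auto simp: \<kappa>_def M_def intro!: add_pos_pos)
  ultimately show "mixing_exponential N \<phi> \<alpha>"
    unfolding mixing_exponential_def by blast
qed

theorem lemmaC1:
  fixes N :: nat and \<phi> :: "nat \<Rightarrow> complex \<Rightarrow> complex"
  assumes "1 \<le> N"
    and "\<forall>j\<in>{1..N}. finite_blaschke_product (\<phi> j)"
    and "\<forall>j\<in>{1..N}. \<phi> j 0 = 0"
    and "\<exists>\<theta>. 0 < \<theta> \<and> \<theta> < 1 \<and> mixing_double_exponential N \<phi> \<theta>"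
  shows "\<forall>\<alpha>. 0 < \<alpha> \<and> \<alpha> \<le> 1 \<longrightarrow> mixing_exponential N \<phi> \<alpha>"
  using assms(2,4) mixing_exponential_if_double_exponential by blast

end
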